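(* Let $\alpha>0$ and $n\ge1$. In the adversarial-order secretary problem with an $\alpha$-power signal (defined in the context), the optimal worst-case success probability for randomized policies is $$\mathrm{OPT}^{\mathrm{rand}}_n(\alpha)=\frac{n^\alpha}{\sum_{j=1}^n j^\alpha}.$$ The policy $\mathcal{A}(\max\{R,S\})$ is optimal, where $R\in[n]$ is a random threshold independent of $S$ with, for $r\in[n]$, $$\Pr[R\le r]=\frac{n^\alpha}{\sum_{j=1}^n j^\alpha}\cdot\frac{\sum_{j=1}^r j^\alpha}{r^\alpha}.$$
   Context: Notation: $[n]=\{1,\dots,n\}$. Adversarial-order secretary problem with an $\alpha$-power signal ($\alpha>0$ real): an adversary fixes an instance, i.e. a value vector $v\in\mathbb{N}_0^n$ with a unique maximum entry, located at a time $i^\star\in[n]$. Items arrive one by one at times $1,\dots,n$ in this order. A signal time $S\in[i^\star]$ is drawn with $$\Pr[S=s]=\frac{s^\alpha-(s-1)^\alpha}{(i^\star)^\alpha},\qquad s\in[i^\star].$$ At each time $t$ the policy observes $v_t$ and whether the content-free signal occurs at time $t$ ($S=t$); it then irrevocably decides whether to stop at time $t$. The policy knows $n$ and $\alpha$, but not the instance. It succeeds if it stops exactly at time $i^\star$. A randomized policy may use internal randomness independent of the signal. The worst-case success probability of a policy is the infimum over all instances of length $n$ of its success probability (over the signal and the internal randomness); $\mathrm{OPT}^{\mathrm{rand}}_n(\alpha)$ is the supremum of the worst-case success probability over all randomized policies, and a policy is optimal if it attains it. A time is a record if the item arriving then is the best item so far. The threshold policy $\mathcal{A}(k)$ rejects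 all items before time $k$ and then accepts the first record from time $k$ onward (including time $k$). *)

theory Defs
  imports "HOL-Probability.Probability"
begin

text \<open>
  Times are 1-based. An instance of length n is a value vector together with the location i
  of its unique maximum.
\<close>

definition instances :: "nat \<Rightarrow> ((nat \<Rightarrow> nat) \<times> nat) set" where
  "instances n = {(v, i). v \<in> {1..n} \<rightarrow>\<^sub>E UNIV \<and> i \<in> {1..n} \<and> (\<forall>j\<in>{1..n} - {i}. v j < v i)}"

definition signal_pmf :: "real \<Rightarrow> nat \<Rightarrow> nat pmf" where
  "signal_pmf \<alpha> i = embed_pmf (\<lambda>s. if s \<in> {1..i}
     then (real s powr \<alpha> - real (s - 1) powr \<alpha>) / real i powr \<alpha> else 0)"

text \<open>The function given to \<open>embed_pmf\<close> is a genuine probability mass function.\<close>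

lemma pmf_signal:
  assumes "\<alpha> > 0" and "i \<ge> 1"
  shows "pmf (signal_pmf \<alpha> i) s = (if s \<in> {1..i}
     then (real s powr \<alpha> - real (s - 1) powr \<alpha>) / real i powr \<alpha> else 0)"
proof -
  define f where "f = (\<lambda>s. if s \<in> {1..i}
     then (real s powr \<alpha> - real (s - 1) powr \<alpha>) / real i powr \<alpha> else 0)"
  have nonneg: "0 \<le> f s" for s
    unfolding f_def using assms by (auto intro!: divide_nonneg_nonneg powr_mono2)
  have tele: "(\<Sum>s=1..m. real s powr \<alpha> - real (s - 1) powr \<alpha>) = real m powr \<alpha>" for m
    by (induction m) auto
  have "(\<Sum>s=1..i. f s) = (\<Sum>s=1..i. real s powr \<alpha> - real (s - 1) powr \<alpha>) / real i powr \<alpha>"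
    by (simp add: f_def sum_divide_distrib)
  also have "\<dots> = 1"
    using assms tele by simp
  finally have sum1: "(\<Sum>s=1..i. f s) = 1" .
  have "(\<integral>\<^sup>+ s. ennreal (f s) \<partial>count_space UNIV) = (\<Sum>s=1..i. ennreal (f s))"
    by (rule nn_integral_count_space') (auto simp: f_def)
  also have "\<dots> = 1"
    using nonneg sum1 by (simp add: sum_ennreal)
  finally have "pmf (embed_pmf f) s = f s"
    using nonneg by (intro pmf_embed_pmf) auto
  then show ?thesis
    unfolding signal_pmf_def f_def .
qed

text \<open>
  A history lists, for the times 1, ..., t seen so far, the value and whether the signal occurred.
  A deterministic policy maps each history to the decision whether to stop now.
\<close>

type_synonym history = "(nat \<times> bool) list"
type_synonym policy = "history \<Rightarrow> bool"

definition history :: "(nat \<Rightarrow> nat) \<Rightarrow> nat \<Rightarrow> nat \<Rightarrow> history" where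
  "history v s t = map (\<lambda>u. (v u, u = s)) [1..<Suc t]"

definition stops_at :: "policy \<Rightarrow> (nat \<Rightarrow> nat) \<Rightarrow> nat \<Rightarrow> nat \<Rightarrow> bool" where
  "stops_at d v s t \<longleftrightarrow> d (history v s t) \<and> (\<forall>u\<in>{1..<t}. \<not> d (history v s u))"

text \<open>
  A randomized policy is the law of a random deterministic policy: internal randomness from a
  probability space M that selects policies by a measurable map f enters through
  \<open>distr M policy_space f\<close>. Independence of the signal is the product measure in
  \<open>success_prob\<close>. As histories are countably many, \<open>policy_space\<close> makes each single
  decision, hence each stopping event, measurable.
\<close>

definition policy_space :: "policy measure" where
  "policy_space = Pi\<^sub>M UNIV (\<lambda>_. count_space UNIV)"

definition randomized_policies :: "policy measure set" where
  "randomized_policies = {Q. prob_space Q \<and> sets Q = sets policy_space}"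

definition success_prob :: "real \<Rightarrow> (nat \<Rightarrow> nat) \<Rightarrow> nat \<Rightarrow> policy measure \<Rightarrow> real" where
  "success_prob \<alpha> v i Q =
     measure (measure_pmf (signal_pmf \<alpha> i) \<Otimes>\<^sub>M Q) {(s, d). stops_at d v s i}"

definition worst_case :: "real \<Rightarrow> nat \<Rightarrow> policy measure \<Rightarrow> real" where
  "worst_case \<alpha> n Q = (INF (v, i)\<in>instances n. success_prob \<alpha> v i Q)"

definition OPT_rand :: "real \<Rightarrow> nat \<Rightarrow> real" where
  "OPT_rand \<alpha> n = (SUP Q\<in>randomized_policies. worst_case \<alpha> n Q)"

definition optimal_policy :: "real \<Rightarrow> nat \<Rightarrow> policy measure \<Rightarrow> bool" where
  "optimal_policy \<alpha> n Q \<longleftrightarrow> Q \<in> randomized_policies \<and> worst_case \<alpha> n Q = OPT_rand \<alpha> n"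

lemma measurable_stops_at:
  "(\<lambda>(s, d). stops_at d v s i) \<in>
     measurable (count_space UNIV \<Otimes>\<^sub>M policy_space) (count_space UNIV)"
proof -
  have dec: "Measurable.pred policy_space (\<lambda>d. d h)" for h
    unfolding policy_space_def by (rule measurable_component_singleton) simp
  have "Measurable.pred policy_space (\<lambda>d. stops_at d v s i)" for s
    unfolding stops_at_def
    by (intro pred_intros_logic pred_intros_finite dec) auto
  then show ?thesis
    by (intro measurable_pair_measure_countable1) auto
qed

definition is_record :: "nat list \<Rightarrow> bool" where
  "is_record xs \<longleftrightarrow> xs \<noteq> [] \<and> (\<forall>x\<in>set (butlast xs). x < last xs)"

text \<open>That only the first record counts is part of \<open>stops_at\<close>.\<close>

definition threshold_policy :: "nat \<Rightarrow> policy" where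
  "threshold_policy k h \<longleftrightarrow> k \<le> length h \<and> is_record (map fst h)"

text \<open>
  The threshold policy with threshold max r S, where S is read off the history. Before the signal
  the current time is below S, so the threshold policy rejects.
\<close>

definition max_threshold_policy :: "nat \<Rightarrow> policy" where
  "max_threshold_policy r h \<longleftrightarrow>
     (\<exists>s\<in>{1..length h}. snd (h ! (s - 1)) \<and> threshold_policy (max r s) h)"

lemma max_threshold_policy_history:
  assumes "s \<ge> 1"
  shows "max_threshold_policy r (history v s t) = threshold_policy (max r s) (history v s t)"
proof -
  have len: "length (history v s t) = t"
    by (simp add: history_def)
  have "snd (history v s t ! (u - 1)) \<longleftrightarrow> u = s" if "u \<in> {1..t}" for u
  proof -
    have "[1..<Suc t] ! (u - 1) = u"
      using that by (subst nth_upt) auto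
    moreover have "u - 1 < length [1..<Suc t]"
      using that by auto
    ultimately show ?thesis
      unfolding history_def by (simp only: nth_map snd_conv)
  qed
  then show ?thesis
    using assms by (auto simp: max_threshold_policy_def threshold_policy_def len)
qed

definition random_max_threshold_policy :: "nat pmf \<Rightarrow> policy measure" where
  "random_max_threshold_policy R = distr (measure_pmf R) policy_space max_threshold_policy"

definition threshold_law :: "real \<Rightarrow> nat \<Rightarrow> nat pmf \<Rightarrow> bool" where
  "threshold_law \<alpha> n R \<longleftrightarrow> set_pmf R \<subseteq> {1..n} \<and>
     (\<forall>r\<in>{1..n}. measure_pmf.prob R {..r} =
        real n powr \<alpha> / (\<Sum>j=1..n. real j powr \<alpha>) *
        ((\<Sum>j=1..r. real j powr \<alpha>) / real r powr \<alpha>))"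

end

theory Submission
  imports Defs
begin

text \<open>
  For the upper bound the adversary picks the position i of the maximum with probability
  proportional to \<open>i powr \<alpha>\<close> and lets the values increase up to time i. Conditionally on the
  signal time s, the position is then uniform on \<open>{s..n}\<close>, and up to the maximum the history
  carries no information about it beyond s. So a policy succeeds at no more than one of these
  positions, which bounds the average success probability.
  For the lower bound, the event that the larger of R and S equals i suffices for success, and the
  law of R makes its probability independent of i.
\<close>

section \<open>Power sums and the distribution function of the threshold\<close>

lemma sum_powr_diff:
  fixes \<alpha> :: real
  shows "(\<Sum>s=1..m. real s powr \<alpha> - real (s - 1) powr \<alpha>) = real m powr \<alpha>"
  by (induction m) auto

lemma sum_powr_pos:
  fixes \<alpha> :: real
  assumes "n \<ge> 1"
  shows "(\<Sum>j=1..n. real j powr \<alpha>) > 0"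
  using assms by (intro sum_pos) auto

text \<open>Needed so that the prescribed distribution function is nondecreasing. Reversing the sum
  writes the ratio as the sum of \<open>(1 - real k / real r) powr \<alpha>\<close> over k < r: no
  term decreases as r grows, and a nonnegative one is added.\<close>

lemma sum_powr_ratio_mono:
  fixes \<alpha> :: real
  assumes "\<alpha> > 0"
  shows "(\<Sum>j=1..r. real j powr \<alpha>) / real r powr \<alpha>
    \<le> (\<Sum>j=1..Suc r. real j powr \<alpha>) / real (Suc r) powr \<alpha>"
proof (cases "r = 0")
  case True
  then show ?thesis by simp
next
  case False
  have rev: "(\<Sum>j=1..m. real j powr \<alpha>) / real m powr \<alpha> = (\<Sum>k<m. (1 - real k / real m) powr \<alpha>)"
    for m
  proof -
    have "(\<Sum>j=1..m. real j powr \<alpha>) / real m powr \<alpha> = (\<Sum>j=1..m. (real j / real m) powr \<alpha>)"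
      by (simp add: sum_divide_distrib powr_divide)
    also have "\<dots> = (\<Sum>k<m. (1 - real k / real m) powr \<alpha>)"
      by (rule sum.reindex_bij_witness[of _ "\<lambda>k. m - k" "\<lambda>j. m - j"])
         (auto simp: of_nat_diff diff_divide_distrib)
    finally show ?thesis .
  qed
  have "(\<Sum>k<r. (1 - real k / real r) powr \<alpha>) \<le> (\<Sum>k<r. (1 - real k / real (Suc r)) powr \<alpha>)"
    using assms False
    by (intro sum_mono powr_mono2 diff_left_mono divide_left_mono) (auto simp: divide_simps)
  also have "\<dots> \<le> (\<Sum>k<Suc r. (1 - real k / real (Suc r)) powr \<alpha>)"
    by simp
  finally show ?thesis
    unfolding rev .
qed

lemma ex_pmf_with_cdf:
  fixes F :: "nat \<Rightarrow> real"
  assumes "F 0 = 0" and "F n = 1" and mono: "\<And>r. F r \<le> F (Suc r)"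
  shows "\<exists>R. set_pmf R \<subseteq> {1..n} \<and> (\<forall>r\<in>{1..n}. measure_pmf.prob R {..r} = F r)"
proof -
  define f where "f r = (if r \<in> {1..n} then F r - F (r - 1) else 0)" for r
  have nonneg: "0 \<le> f r" for r
    using mono[of "r - 1"] by (auto simp: f_def)
  have tele: "(\<Sum>r=1..m. F r - F (r - 1)) = F m" for m
    by (induction m) (auto simp: assms(1))
  have "(\<integral>\<^sup>+ r. ennreal (f r) \<partial>count_space UNIV) = (\<Sum>r=1..n. ennreal (f r))"
    by (rule nn_integral_count_space') (auto simp: f_def)
  also have "\<dots> = ennreal (\<Sum>r=1..n. f r)"
    using nonneg by (simp add: sum_ennreal)
  also have "(\<Sum>r=1..n. f r) = 1"
    using tele[of n] assms(2) by (simp add: f_def)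
  finally have pmf: "pmf (embed_pmf f) r = f r" for r
    using nonneg by (intro pmf_embed_pmf) auto
  have "measure_pmf.prob (embed_pmf f) {..r} = F r" if "r \<in> {1..n}" for r
  proof -
    have "measure_pmf.prob (embed_pmf f) {..r} = (\<Sum>j\<le>r. f j)"
      by (simp add: measure_measure_pmf_finite pmf)
    also have "\<dots> = (\<Sum>j=1..r. F j - F (j - 1))"
      using that by (intro sum.mono_neutral_cong_right) (auto simp: f_def)
    finally show ?thesis
      using tele by simp
  qed
  moreover have "set_pmf (embed_pmf f) \<subseteq> {1..n}"
    by (auto simp: set_pmf_iff pmf f_def split: if_splits)
  ultimately show ?thesis by blast
qed

text \<open>Optimality is claimed for every R with \<open>threshold_law\<close>; existence keeps
  that claim from being vacuous.\<close>

lemma ex_threshold_law: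
  assumes "\<alpha> > 0" and "n \<ge> 1"
  shows "\<exists>R. threshold_law \<alpha> n R"
  unfolding threshold_law_def
proof (rule ex_pmf_with_cdf)
  show "real n powr \<alpha> / (\<Sum>j=1..n. real j powr \<alpha>) *
      ((\<Sum>j=1..n. real j powr \<alpha>) / real n powr \<alpha>) = 1"
    using sum_powr_pos[OF assms(2), of \<alpha>] assms by simp
  fix r
  show "real n powr \<alpha> / (\<Sum>j=1..n. real j powr \<alpha>) *
        ((\<Sum>j=1..r. real j powr \<alpha>) / real r powr \<alpha>)
      \<le> real n powr \<alpha> / (\<Sum>j=1..n. real j powr \<alpha>) *
        ((\<Sum>j=1..Suc r. real j powr \<alpha>) / real (Suc r) powr \<alpha>)"
    using assms
    by (intro mult_left_mono sum_powr_ratio_mono divide_nonneg_nonneg sum_nonneg) auto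
\<comment> \<open>What remains is the value 0 at r = 0, where the sum is empty.\<close>
qed simp

section \<open>Success probability as a sum over signal times\<close>

lemma pred_stops_at [measurable]: "Measurable.pred policy_space (\<lambda>d. stops_at d v s i)"
  using measurable_compose[OF measurable_Pair1'[of s "count_space UNIV"] measurable_stops_at] by simp

lemma space_policy_space [simp]: "space policy_space = UNIV"
  by (simp add: policy_space_def space_PiM)

lemma sets_stops_at:
  assumes "Q \<in> randomized_policies"
  shows "{d. stops_at d v s i} \<in> sets Q"
  using assms pred_stops_at[of v s i] by (simp add: randomized_policies_def pred_def)

text \<open>Fubini for the product measure: one conditions on the signal, which has finite
  support.\<close>

lemma success_prob_eq:
  assumes "Q \<in> randomized_policies" and "\<alpha> > 0" and "i \<ge> 1"
  shows "success_prob \<alpha> v i Q =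
    (\<Sum>s=1..i. (real s powr \<alpha> - real (s - 1) powr \<alpha>) / real i powr \<alpha>
       * measure Q {d. stops_at d v s i})"
proof -
  let ?p = "signal_pmf \<alpha> i" and ?A = "{(s, d). stops_at d v s i}"
  interpret Q: prob_space Q
    using assms by (simp add: randomized_policies_def)
  have setsQ: "sets Q = sets policy_space"
    using assms by (simp add: randomized_policies_def)
  then have spaceQ: "space Q = UNIV"
    by (metis sets_eq_imp_space_eq space_policy_space)
  \<comment> \<open>\<open>measurable_stops_at\<close> speaks of \<open>policy_space\<close>, and Q
    shares its measurable sets.\<close>
  have sets_eq: "sets (measure_pmf ?p \<Otimes>\<^sub>M Q) = sets (count_space UNIV \<Otimes>\<^sub>M policy_space)"
    using setsQ by (intro sets_pair_measure_cong) auto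
  have "?A \<in> sets (count_space UNIV \<Otimes>\<^sub>M policy_space)"
    using measurable_sets[OF measurable_stops_at[of v i], of "{True}"]
    by (simp add: space_pair_measure vimage_def case_prod_unfold)
  then have A: "?A \<in> sets (measure_pmf ?p \<Otimes>\<^sub>M Q)"
    using sets_eq by simp
  have "emeasure (measure_pmf ?p \<Otimes>\<^sub>M Q) ?A
      = (\<integral>\<^sup>+ s. emeasure Q {d. stops_at d v s i} \<partial>measure_pmf ?p)"
    by (subst Q.emeasure_pair_measure_alt[OF A]) (simp add: vimage_def)
  also have "\<dots> = (\<integral>\<^sup>+ s. ennreal (measure Q {d. stops_at d v s i}) \<partial>measure_pmf ?p)"
    by (simp add: Q.emeasure_eq_measure)
  also have "\<dots> = (\<Sum>s=1..i. ennreal (measure Q {d. stops_at d v s i}) * pmf ?p s)"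
    using assms
    by (intro nn_integral_measure_pmf_support) (auto simp: set_pmf_iff pmf_signal split: if_splits)
  also have "\<dots> = ennreal (\<Sum>s=1..i. pmf ?p s * measure Q {d. stops_at d v s i})"
    by (simp add: ennreal_mult' mult.commute flip: sum_ennreal)
  finally have "success_prob \<alpha> v i Q = (\<Sum>s=1..i. pmf ?p s * measure Q {d. stops_at d v s i})"
    unfolding success_prob_def measure_def by (simp add: sum_nonneg measure_def[symmetric])
  then show ?thesis
    using assms by (simp add: pmf_signal)
qed

lemma success_prob_nonneg: "success_prob \<alpha> v i Q \<ge> 0"
  by (simp add: success_prob_def)

section \<open>Upper bound from increasing instances\<close>

lemma worst_case_le:
  assumes "(v, i) \<in> instances n"
  shows "worst_case \<alpha> n Q \<le> success_prob \<alpha> v i Q"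
proof -
  have "bdd_below ((\<lambda>(v, i). success_prob \<alpha> v i Q) ` instances n)"
    by (rule bdd_belowI[of _ 0]) (auto simp: success_prob_nonneg)
  from cINF_lower[OF this assms] show ?thesis
    by (simp add: worst_case_def)
qed

text \<open>Up to time i the values agree with \<open>id\<close>, so they do not reveal i; the zeros
  afterwards make i the unique maximum. \<open>restrict\<close> is there because
  \<open>instances\<close> asks for extensional functions.\<close>

definition increasing_until :: "nat \<Rightarrow> nat \<Rightarrow> nat \<Rightarrow> nat" where
  "increasing_until n i = restrict (\<lambda>j. if j \<le> i then j else 0) {1..n}"

lemma increasing_until_instance:
  assumes "i \<in> {1..n}"
  shows "(increasing_until n i, i) \<in> instances n"
  using assms by (auto simp: instances_def increasing_until_def)

lemma history_increasing_until:
  assumes "i \<le> n" and "t \<le> i"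
  shows "history (increasing_until n i) s t = history id s t"
  using assms by (auto simp: history_def increasing_until_def)

lemma stops_at_increasing_until:
  assumes "i \<in> {1..n}"
  shows "stops_at d (increasing_until n i) s i = stops_at d id s i"
  using assms history_increasing_until[of i n] by (auto simp: stops_at_def)

text \<open>For fixed v and s a policy stops at most once, so the events are disjoint. Time 0 is
  excluded because \<open>stops_at\<close> checks earlier times from 1 only: stopping at 0 would not
  rule out a later stop.\<close>

lemma sum_stops_at_le_1:
  assumes "Q \<in> randomized_policies" and "finite I" and "0 \<notin> I"
  shows "(\<Sum>i\<in>I. measure Q {d. stops_at d v s i}) \<le> 1"
proof -
  interpret prob_space Q
    using assms by (simp add: randomized_policies_def)
  have "disjoint_family_on (\<lambda>i. {d. stops_at d v s i}) I"
  proof (unfold disjoint_family_on_def, safe)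
    fix i j d
    assume "i \<in> I" "j \<in> I" "i \<noteq> j" "stops_at d v s i" "stops_at d v s j"
    moreover have "1 \<le> i" "1 \<le> j"
      using \<open>i \<in> I\<close> \<open>j \<in> I\<close> assms(3) by (auto simp: Suc_le_eq intro: gr0I)
    ultimately show "d \<in> {}"
      by (cases i j rule: linorder_cases) (auto simp: stops_at_def)
  qed
  then have "(\<Sum>i\<in>I. measure Q {d. stops_at d v s i}) = measure Q (\<Union>i\<in>I. {d. stops_at d v s i})"
    using assms sets_stops_at[OF assms(1)]
    by (subst finite_measure_finite_Union) auto
  then show ?thesis
    by simp
qed

lemma worst_case_upper_bound:
  assumes Q: "Q \<in> randomized_policies" and \<alpha>: "\<alpha> > 0" and n: "n \<ge> 1"
  shows "worst_case \<alpha> n Q \<le> real n powr \<alpha> / (\<Sum>j=1..n. real j powr \<alpha>)"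
proof -
  let ?w = "\<lambda>s. real s powr \<alpha> - real (s - 1) powr \<alpha>"
  let ?q = "\<lambda>s i. measure Q {d. stops_at d id s i}"
  have w: "?w s \<ge> 0" for s
    using \<alpha> by (auto intro!: powr_mono2)
  \<comment> \<open>The factor \<open>real i powr \<alpha>\<close> cancels the denominator of the
    signal law, so the weight \<open>?w s\<close> does not depend on i.\<close>
  have success: "real i powr \<alpha> * success_prob \<alpha> (increasing_until n i) i Q = (\<Sum>s=1..i. ?w s * ?q s i)"
    if "i \<in> {1..n}" for i
    using that Q \<alpha>
    by (auto simp: success_prob_eq stops_at_increasing_until sum_distrib_left intro!: sum.cong)
  have "worst_case \<alpha> n Q * (\<Sum>i=1..n. real i powr \<alpha>) = (\<Sum>i=1..n. real i powr \<alpha> * worst_case \<alpha> n Q)"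
    by (simp add: sum_distrib_left mult.commute)
  also have "\<dots> \<le> (\<Sum>i=1..n. real i powr \<alpha> * success_prob \<alpha> (increasing_until n i) i Q)"
    by (intro sum_mono mult_left_mono worst_case_le increasing_until_instance) auto
  also have "\<dots> = (\<Sum>i=1..n. \<Sum>s=1..i. ?w s * ?q s i)"
    using success by (intro sum.cong) auto
  \<comment> \<open>Adding the nonnegative terms with s > i makes the index range a rectangle, so
    the sums can be swapped.\<close>
  also have "\<dots> \<le> (\<Sum>i=1..n. \<Sum>s=1..n. ?w s * ?q s i)"
    by (intro sum_mono sum_mono2 mult_nonneg_nonneg measure_nonneg w) auto
  also have "\<dots> = (\<Sum>s=1..n. ?w s * (\<Sum>i=1..n. ?q s i))"
    by (subst sum.swap) (simp add: sum_distrib_left)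
  \<comment> \<open>For each s all positions i share the sequence \<open>id\<close>, so a policy is
    right at no more than one of them.\<close>
  also have "\<dots> \<le> (\<Sum>s=1..n. ?w s * 1)"
    using Q by (intro sum_mono mult_left_mono sum_stops_at_le_1 w) auto
  also have "\<dots> = real n powr \<alpha>"
    using sum_powr_diff by simp
  finally show ?thesis
    using sum_powr_pos[OF n, of \<alpha>] by (simp add: pos_le_divide_eq)
qed

section \<open>Lower bound for the random threshold\<close>

lemma measurable_max_threshold_policy:
  "max_threshold_policy \<in> measurable (measure_pmf R) policy_space"
  by simp

lemma random_max_threshold_policy_in:
  "random_max_threshold_policy R \<in> randomized_policies"
  using measure_pmf.prob_space_distr[OF measurable_max_threshold_policy]
  by (simp add: randomized_policies_def random_max_threshold_policy_def)

lemma is_record_history_max: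
  assumes "(v, i) \<in> instances n"
  shows "is_record (map fst (history v s i))"
proof -
  have "i \<in> {1..n}" and "\<forall>j\<in>{1..n} - {i}. v j < v i"
    using assms by (auto simp: instances_def)
  then show ?thesis
    by (auto simp: is_record_def history_def)
qed

text \<open>Times before i lie below the threshold, and the maximum at i is a record.\<close>

lemma stops_at_max_threshold_policy:
  assumes "(v, i) \<in> instances n" and "s \<ge> 1" and "max r s = i"
  shows "stops_at (max_threshold_policy r) v s i"
  using assms is_record_history_max[OF assms(1), of s]
  by (auto simp: stops_at_def max_threshold_policy_history threshold_policy_def)
     (auto simp: history_def)

lemma success_prob_random_max_threshold_policy:
  assumes \<alpha>: "\<alpha> > 0" and vi: "(v, i) \<in> instances n" and R: "threshold_law \<alpha> n R"
  shows "success_prob \<alpha> v i (random_max_threshold_policy R)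
    \<ge> real n powr \<alpha> / (\<Sum>j=1..n. real j powr \<alpha>)"
proof -
  let ?w = "\<lambda>s. real s powr \<alpha> - real (s - 1) powr \<alpha>"
  let ?q = "\<lambda>s. measure (random_max_threshold_policy R) {d. stops_at d v s i}"
  let ?F = "\<lambda>r. measure_pmf.prob R {..r}"
  define c where "c = real n powr \<alpha> / (\<Sum>j=1..n. real j powr \<alpha>)"
  define H where "H r = (\<Sum>j=1..r. real j powr \<alpha>)" for r
  have i: "1 \<le> i" "i \<le> n"
    using vi by (auto simp: instances_def)
  have w: "?w s \<ge> 0" for s
    using \<alpha> by (auto intro!: powr_mono2)
  \<comment> \<open>Multiplied out, the law of R also covers r = 0, where both sides are 0; this is
    needed for i - 1 when i = 1.\<close>
  have F: "?F r * real r powr \<alpha> = c * H r" if "r \<le> n" for r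
    using that R by (cases "r = 0") (auto simp: threshold_law_def c_def H_def)
  have q: "?q s \<ge> measure_pmf.prob R {r. max r s = i}" if "s \<ge> 1" for s
  proof -
    have "{d. stops_at d v s i} \<in> sets policy_space"
      using pred_stops_at[of v s i] by (simp add: pred_def)
    then have "?q s = measure_pmf.prob R {r. stops_at (max_threshold_policy r) v s i}"
      by (simp add: random_max_threshold_policy_def vimage_def
          measure_distr[OF measurable_max_threshold_policy])
    then show ?thesis
      using stops_at_max_threshold_policy[OF vi that]
      by (auto intro!: measure_pmf.finite_measure_mono)
  qed
  \<comment> \<open>With the signal at i the event is that R is at most i; with an earlier signal it
    is R = i, whose probability is an increment of the distribution function.\<close>
  have qi: "measure_pmf.prob R {r. max r i = i} = ?F i"
    by (rule arg_cong[where f = "measure_pmf.prob R"]) auto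
  have qs: "measure_pmf.prob R {r. max r s = i} = ?F i - ?F (i - 1)" if "s \<in> {1..i - 1}" for s
  proof -
    have "{r. max r s = i} = {..i} - {..i - 1}"
      using that by auto
    then show ?thesis
      by (simp add: measure_pmf.finite_measure_Diff)
  qed
  have split: "{1..i} = insert i {1..i - 1}"
    using i by auto
  \<comment> \<open>This telescoping explains the form of the law of R. Splitting
    \<open>real i powr \<alpha>\<close> into \<open>?w i\<close> and
    \<open>real (i - 1) powr \<alpha>\<close> separates the signal at i from the earlier ones, whose
    weights sum to the latter.\<close>
  have "c * real i powr \<alpha> = c * H i - c * H (i - 1)"
    using i by (cases i) (simp_all add: H_def algebra_simps)
  also have "\<dots> = ?F i * real i powr \<alpha> - ?F (i - 1) * real (i - 1) powr \<alpha>"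
    using F[of i] F[of "i - 1"] i by simp
  also have "\<dots> = ?w i * ?F i + (\<Sum>s=1..i - 1. ?w s) * (?F i - ?F (i - 1))"
    unfolding sum_powr_diff by (simp add: algebra_simps)
  also have "\<dots> = ?w i * ?F i + (\<Sum>s=1..i - 1. ?w s * (?F i - ?F (i - 1)))"
    by (simp only: sum_distrib_right)
  also have "\<dots> = (\<Sum>s=1..i. ?w s * measure_pmf.prob R {r. max r s = i})"
    using i qs by (subst split) (simp add: qi)
  also have "\<dots> \<le> (\<Sum>s=1..i. ?w s * ?q s)"
    using q by (intro sum_mono mult_left_mono w) auto
  also have "\<dots> = real i powr \<alpha> * success_prob \<alpha> v i (random_max_threshold_policy R)"
    using i \<alpha> by (simp add: success_prob_eq random_max_threshold_policy_in sum_distrib_left)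
  finally have "real i powr \<alpha> * c \<le> real i powr \<alpha> * success_prob \<alpha> v i (random_max_threshold_policy R)"
    by (simp only: mult.commute)
  moreover have "real i powr \<alpha> > 0"
    using i by simp
  ultimately show ?thesis
    unfolding c_def by (rule mult_left_le_imp_le)
qed

theorem theorem4:
  fixes \<alpha> :: real and n :: nat
  assumes "\<alpha> > 0" and "n \<ge> 1"
  shows "OPT_rand \<alpha> n = real n powr \<alpha> / (\<Sum>j=1..n. real j powr \<alpha>) \<and>
    (\<exists>R. threshold_law \<alpha> n R) \<and>
    (\<forall>R. threshold_law \<alpha> n R \<longrightarrow> optimal_policy \<alpha> n (random_max_threshold_policy R))"
proof -
  let ?c = "real n powr \<alpha> / (\<Sum>j=1..n. real j powr \<alpha>)"
  have upper: "worst_case \<alpha> n Q \<le> ?c" if "Q \<in> randomized_policies" for Q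
    using worst_case_upper_bound[OF that assms] .
  \<comment> \<open>\<open>cINF_greatest\<close> asks for a nonempty index set.\<close>
  have "instances n \<noteq> {}"
    using increasing_until_instance[of n n] assms by auto
  then have "worst_case \<alpha> n (random_max_threshold_policy R) \<ge> ?c" if "threshold_law \<alpha> n R" for R
    unfolding worst_case_def using success_prob_random_max_threshold_policy[OF assms(1) _ that]
    by (intro cINF_greatest) auto
  then have attained: "worst_case \<alpha> n (random_max_threshold_policy R) = ?c"
    if "threshold_law \<alpha> n R" for R
    using upper[OF random_max_threshold_policy_in] that by (simp add: antisym)
  obtain R where R: "threshold_law \<alpha> n R"
    using ex_threshold_law[OF assms] by blast
  have "OPT_rand \<alpha> n = ?c"
    unfolding OPT_rand_def
    using upper attained[OF R] random_max_threshold_policy_in[of R]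
    by (intro cSup_eq_maximum) (auto simp: image_iff intro!: bexI[of _ "random_max_threshold_policy R"])
  then show ?thesis
    using R attained random_max_threshold_policy_in by (auto simp: optimal_policy_def)
qed

end
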